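(* Let $A\subset\mathbb{Z}^d$ be a spectral set in $\mathbb{Z}^d$ with $|A|\le 5$. Then $A$ tiles $\mathbb{Z}^d$ by translation.
   Context: The characters of $\mathbb{Z}^d$ are identified with points $\lambda\in\mathbb{T}^d=\mathbb{R}^d/\mathbb{Z}^d$ via $x\mapsto e^{2\pi i\lambda\cdot x}$. A finite set $A\subset\mathbb{Z}^d$ is spectral if there exists $\Lambda\subset\mathbb{T}^d$ such that the functions $x\mapsto e^{2\pi i\lambda\cdot x}$, $\lambda\in\Lambda$, form an orthogonal basis of $\ell^2(A)$ (counting measure). $A$ tiles $\mathbb{Z}^d$ by translation if there exists $T\subseteq\mathbb{Z}^d$ with $\sum_{t\in T}\chi_A(x-t)=1$ for all $x\in\mathbb{Z}^d$. *)

theory Defs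
  imports "HOL-Analysis.Analysis"
begin

text \<open>Points of Z^d are int^'d; a frequency lambda in T^d is represented by a
  real vector (any representative; orthogonality forces distinct classes mod Z^d).\<close>

definition character :: "real ^ 'd \<Rightarrow> int ^ 'd \<Rightarrow> complex" where
  "character l x = exp (2 * pi * \<i> * complex_of_real (\<Sum>i\<in>UNIV. l $ i * real_of_int (x $ i)))"

definition spectral :: "(int ^ 'd) set \<Rightarrow> bool" where
  "spectral A \<longleftrightarrow> finite A \<and>
     (\<exists>\<Lambda> :: (real ^ 'd) set. finite \<Lambda> \<and>
        (\<forall>l\<in>\<Lambda>. \<forall>m\<in>\<Lambda>. l \<noteq> m \<longrightarrow>
            (\<Sum>x\<in>A. character l x * cnj (character m x)) = 0) \<and>
        (\<forall>f :: int ^ 'd \<Rightarrow> complex. \<exists>c :: real ^ 'd \<Rightarrow> complex.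
            \<forall>x\<in>A. f x = (\<Sum>l\<in>\<Lambda>. c l * character l x)))"

definition tiles :: "(int ^ 'd) set \<Rightarrow> bool" where
  "tiles A \<longleftrightarrow> (\<exists>T :: (int ^ 'd) set. \<forall>x. card {t\<in>T. x - t \<in> A} = 1)"

end

theory Submission
  imports Defs
begin

text \<open>The matrix of values of the characters in \<open>\<Lambda>\<close> on \<open>A\<close> is a complex Hadamard matrix \<open>h\<close>. If the
  quotient \<open>\<psi>\<close> of two of the characters takes on \<open>A\<close> exactly the values \<open>\<omega> * c\<close> with \<open>\<omega>\<close> running
  through the \<open>n\<close>-th roots of unity, then \<open>A\<close> is, up to a translation, a set of representatives
  of the subgroup \<open>\<psi>\<^sup>n = 1\<close> modulo the kernel of \<open>\<psi>\<close>, hence tiles. Three unimodular numbers with sum zero are always of this form.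
  Four are two antipodal pairs, and comparing three rows yields quotients \<open>\<phi>\<close>, \<open>\<psi>\<close> such that \<open>\<phi>\<close>
  separates two pairs, each of which is separated by \<open>\<psi>\<close>.

  For \<open>|A| = 5\<close> it suffices to find two characters whose squares are orthogonal as well, by Newton's
  identities. Take three characters \<open>u, v, w\<close>. Orthogonality to the other two allows to rescale so
  that the vectors \<open>(u k, v k, w k)\<close> have real inner products, that is, they span a real form
  \<open>W\<close> of \<open>\<complex>\<^sup>3\<close>. The quadratic forms \<open>|u|\<^sup>2 - |v|\<^sup>2\<close> and \<open>|v|\<^sup>2 - |w|\<^sup>2\<close> on \<open>W\<close> vanish at
  five points in general enough position, so they are proportional: some nontrivial
  \<open>\<alpha> |u|\<^sup>2 + \<beta> |v|\<^sup>2 + \<gamma> |w|\<^sup>2\<close> vanishes on \<open>W\<close>. Then \<open>diag \<alpha> \<beta> \<gamma>\<close> is given on \<open>W\<close> by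
  \<open>\<i>\<close> times an antisymmetric real matrix of odd size, hence has a kernel vector in \<open>W\<close>, and
  this gives \<open>v * w = \<kappa> * u\<^sup>2\<close> up to renaming.\<close>

section \<open>Unimodular numbers with vanishing sum\<close>

lemma cnj_mult_unit: "norm (z::complex) = 1 \<Longrightarrow> z * cnj z = 1"
  by (simp add: complex_norm_square[symmetric])

lemma unit_inverse: "norm (z::complex) = 1 \<Longrightarrow> inverse z = cnj z"
  by (metis cnj_mult_unit inverse_unique)

text \<open>On the unit circle conjugation is inversion, so conjugating the sum also makes the
  second elementary symmetric function vanish: all three numbers are roots of t^3 = x y z.\<close>

lemma cubes_equal:
  fixes x y z :: complex
  assumes n: "norm x = 1" "norm y = 1" "norm z = 1" and s: "x + y + z = 0"
  shows "x \<noteq> y \<and> x ^ 3 = y ^ 3"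
proof -
  note c = cnj_mult_unit[OF n(1)] cnj_mult_unit[OF n(2)] cnj_mult_unit[OF n(3)]
  have "cnj x + cnj y + cnj z = 0" using arg_cong[OF s, of cnj] by simp
  hence e2: "x * y + y * z + z * x = 0" using c by algebra
  hence q: "x\<^sup>2 + x * y + y\<^sup>2 = 0" using s by algebra
  hence "x ^ 3 = y ^ 3" by algebra
  moreover have "x \<noteq> y"
  proof
    assume "x = y"
    hence "3 * x\<^sup>2 = 0" using q by (simp add: power2_eq_square)
    thus False using n(1) by auto
  qed
  ultimately show ?thesis by blast
qed

text \<open>The two power sums give e1 = e2 = 0 by Newton's identities. Conjugation exchanges ek and
  e(5-k) up to the unimodular factor \<open>P\<close>, so e3 = e4 = 0 too, and the numbers are roots
  of y^5 = \<open>P\<close>.\<close>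

lemma fifth_powers_equal:
  fixes x1 x2 x3 x4 x5 :: complex
  assumes n: "norm x1 = 1" "norm x2 = 1" "norm x3 = 1" "norm x4 = 1" "norm x5 = 1"
    and s1: "x1 + x2 + x3 + x4 + x5 = 0"
    and s2: "x1\<^sup>2 + x2\<^sup>2 + x3\<^sup>2 + x4\<^sup>2 + x5\<^sup>2 = 0"
  shows "x1 ^ 5 = x2 ^ 5" "x1 \<noteq> x2"
proof -
  define P where "P = x1 * x2 * x3 * x4 * x5"
  define e2 where "e2 = x1*x2+x1*x3+x1*x4+x1*x5+x2*x3+x2*x4+x2*x5+x3*x4+x3*x5+x4*x5"
  define e3 where "e3 = x1*x2*x3+x1*x2*x4+x1*x2*x5+x1*x3*x4+x1*x3*x5+x1*x4*x5+x2*x3*x4+x2*x3*x5+x2*x4*x5+x3*x4*x5"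
  define e4 where "e4 = x1*x2*x3*x4+x1*x2*x3*x5+x1*x2*x4*x5+x1*x3*x4*x5+x2*x3*x4*x5"
  note c = cnj_mult_unit[OF n(1)] cnj_mult_unit[OF n(2)] cnj_mult_unit[OF n(3)]
    cnj_mult_unit[OF n(4)] cnj_mult_unit[OF n(5)]
  have "(x1 + x2 + x3 + x4 + x5)\<^sup>2 = (x1\<^sup>2 + x2\<^sup>2 + x3\<^sup>2 + x4\<^sup>2 + x5\<^sup>2) + 2 * e2"
    unfolding e2_def by (simp add: power2_eq_square algebra_simps)
  hence e2: "e2 = 0" using s1 s2 by simp
  have "e4 = P * cnj (x1 + x2 + x3 + x4 + x5)"
  proof -
    have "P * cnj (x1 + x2 + x3 + x4 + x5) = (x1 * cnj x1) * (x2*x3*x4*x5) + (x2 * cnj x2) * (x1*x3*x4*x5)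
      + (x3 * cnj x3) * (x1*x2*x4*x5) + (x4 * cnj x4) * (x1*x2*x3*x5) + (x5 * cnj x5) * (x1*x2*x3*x4)"
      unfolding P_def by (simp add: algebra_simps)
    thus ?thesis unfolding c e4_def by simp
  qed
  hence e4: "e4 = 0" using s1 by simp
  have "e3 = P * cnj e2"
  proof -
    have "P * cnj e2 = (x1 * cnj x1) * (x2 * cnj x2) * (x3*x4*x5) + (x1 * cnj x1) * (x3 * cnj x3) * (x2*x4*x5)
      + (x1 * cnj x1) * (x4 * cnj x4) * (x2*x3*x5) + (x1 * cnj x1) * (x5 * cnj x5) * (x2*x3*x4)
      + (x2 * cnj x2) * (x3 * cnj x3) * (x1*x4*x5) + (x2 * cnj x2) * (x4 * cnj x4) * (x1*x3*x5)
      + (x2 * cnj x2) * (x5 * cnj x5) * (x1*x3*x4) + (x3 * cnj x3) * (x4 * cnj x4) * (x1*x2*x5)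
      + (x3 * cnj x3) * (x5 * cnj x5) * (x1*x2*x4) + (x4 * cnj x4) * (x5 * cnj x5) * (x1*x2*x3)"
      unfolding P_def e2_def by (simp add: algebra_simps)
    thus ?thesis unfolding c e3_def by simp
  qed
  hence e3: "e3 = 0" using e2 by simp
  have char: "y ^ 5 - P = (y - x1) * (y - x2) * (y - x3) * (y - x4) * (y - x5)" for y
  proof -
    have "(y - x1) * (y - x2) * (y - x3) * (y - x4) * (y - x5)
      = y ^ 5 - (x1 + x2 + x3 + x4 + x5) * y ^ 4 + e2 * y ^ 3 - e3 * y\<^sup>2 + e4 * y - P"
      unfolding e2_def e3_def e4_def P_def by (simp add: eval_nat_numeral algebra_simps)
    thus ?thesis using s1 e2 e3 e4 by simp
  qed
  have "x1 ^ 5 = P" "x2 ^ 5 = P" using char[of x1] char[of x2] by simp_all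
  thus "x1 ^ 5 = x2 ^ 5" by simp
  show "x1 \<noteq> x2"
  proof
    assume "x1 = x2"
    \<comment> \<open>Both sides are the derivative at \<open>x1\<close> of the monic quintic with
      roots \<open>x1\<close>, ..., \<open>x5\<close>; a double root would make it vanish.\<close>
    have "(x1 - x2) * (x1 - x3) * (x1 - x4) * (x1 - x5)
      = 5 * x1 ^ 4 - 4 * (x1 + x2 + x3 + x4 + x5) * x1 ^ 3 + 3 * e2 * x1\<^sup>2 - 2 * e3 * x1 + e4"
      unfolding e2_def e3_def e4_def by (simp add: eval_nat_numeral algebra_simps)
    hence "5 * x1 ^ 4 = (x1 - x2) * (x1 - x3) * (x1 - x4) * (x1 - x5)"
      unfolding s1 e2 e3 e4 by simp
    hence "5 * x1 ^ 4 = 0" using \<open>x1 = x2\<close> by simp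
    thus False using n(1) by auto
  qed
qed

text \<open>The third elementary symmetric function vanishes by conjugation, and (p + q)(p + r)(p +
  s) = p^2 e1 + e3, so \<open>p\<close> is opposite to one of the others.\<close>

lemma zero_sum_four_antipodal:
  fixes p q r s :: complex
  assumes n: "norm p = 1" "norm q = 1" "norm r = 1" "norm s = 1" and s0: "p + q + r + s = 0"
  shows "q = - p \<and> s = - r \<or> r = - p \<and> s = - q \<or> s = - p \<and> r = - q"
proof -
  note c = cnj_mult_unit[OF n(1)] cnj_mult_unit[OF n(2)] cnj_mult_unit[OF n(3)] cnj_mult_unit[OF n(4)]
  have "q * r * s + p * r * s + p * q * s + p * q * r = p * q * r * s * cnj (p + q + r + s)"
  proof -
    have "p * q * r * s * cnj (p + q + r + s) = (p * cnj p) * (q * r * s) + (q * cnj q) * (p * r * s)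
      + (r * cnj r) * (p * q * s) + (s * cnj s) * (p * q * r)"
      by (simp add: algebra_simps)
    thus ?thesis unfolding c by simp
  qed
  hence e3: "q * r * s + p * r * s + p * q * s + p * q * r = 0" using s0 by simp
  have "(p + q) * (p + r) * (p + s) = p\<^sup>2 * (p + q + r + s) + (q * r * s + p * r * s + p * q * s + p * q * r)"
    by (simp add: power2_eq_square algebra_simps)
  hence "p + q = 0 \<or> p + r = 0 \<or> p + s = 0" using s0 e3 by simp
  moreover have "q = - p" "s = - r" if "p + q = 0" using that s0 by (auto simp: eq_neg_iff_add_eq_0 add_ac)
  moreover have "r = - p" "s = - q" if "p + r = 0" using that s0
    by (auto simp: eq_neg_iff_add_eq_0 add_ac) (metis add.assoc add.commute add_0)
  moreover have "s = - p" "r = - q" if "p + s = 0" using that s0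
    by (auto simp: eq_neg_iff_add_eq_0 add_ac) (metis add.assoc add.commute add_0)
  ultimately show ?thesis by blast
qed

lemma zero_sum_no_triple:
  fixes x y y' :: complex
  assumes "norm x = 1" "norm y = 1" "norm y' = 1"
  shows "x + x + x + y + y' \<noteq> 0"
proof
  assume "x + x + x + y + y' = 0"
  hence "3 * x = - (y + y')" by (simp add: algebra_simps eq_neg_iff_add_eq_0)
  hence "3 = norm (y + y')" using assms(1) by (metis norm_minus_cancel norm_mult norm_numeral mult.right_neutral)
  also have "\<dots> \<le> 2" using norm_triangle_ineq[of y y'] assms by simp
  finally show False by simp
qed

lemma card_five_split:
  assumes "card I = 5" "p \<in> I" "q \<in> I" "p \<noteq> q"
  obtains r s t where "I = {p,q,r,s,t}" "distinct [p,q,r,s,t]"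
proof -
  have fin: "finite I" using assms(1) by (metis card.infinite zero_neq_numeral)
  have "card (I - {p,q}) = 3" using assms fin by (simp add: card_Diff_subset)
  then obtain r s t where *: "I - {p,q} = {r,s,t}" "r \<noteq> s" "s \<noteq> t" "r \<noteq> t"
    unfolding card_3_iff by blast
  have "{p,q} \<inter> {r,s,t} = {}" unfolding *(1)[symmetric] by blast
  hence "distinct [p,q,r,s,t]" using * assms(4) by (simp add: eq_commute)
  moreover have "I = {p,q} \<union> (I - {p,q})" using assms by blast
  hence "I = {p,q,r,s,t}" unfolding *(1) by auto
  ultimately show ?thesis using that by iprover
qed

text \<open>By \<open>zero_sum_no_triple\<close> each value occurs at most twice. If
  \<open>p\<close>, \<open>q\<close> share a value, the other three avoid it and are not all equal,
  so \<open>q\<close> and two of them with different values form the triple \<open>c\<close>,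
  \<open>d\<close>, \<open>e\<close>.\<close>

lemma labelling_of_zero_sum:
  fixes x :: "'a \<Rightarrow> complex"
  assumes I: "card I = 5" and x1: "\<And>k. k \<in> I \<Longrightarrow> norm (x k) = 1" and s0: "(\<Sum>k\<in>I. x k) = 0"
  obtains a b c d e where "I = {a,b,c,d,e}" "distinct [a,b,c,d,e]" "x a \<noteq> x b"
    "x c \<noteq> x d" "x d \<noteq> x e" "x c \<noteq> x e"
proof -
  have fin: "finite I" using I by (metis card.infinite zero_neq_numeral)
  have no3: "\<not> (x p = x q \<and> x q = x r)" if "I = {p,q,r,s,t}" "distinct [p,q,r,s,t]" for p q r s t
    using s0 zero_sum_no_triple[of "x p" "x s" "x t"] x1 that by (auto simp: add.assoc)
  show ?thesis
  proof (cases "inj_on x I")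
    case True
    have "\<not> card I \<le> Suc 0" using I by simp
    then obtain p q where "p \<in> I" "q \<in> I" "p \<noteq> q"
      unfolding card_le_Suc0_iff_eq[OF fin] by blast
    obtain r s t where *: "I = {p,q,r,s,t}" "distinct [p,q,r,s,t]"
      by (rule card_five_split[OF I \<open>p \<in> I\<close> \<open>q \<in> I\<close> \<open>p \<noteq> q\<close>]) (rule that; assumption)
    have "distinct (map x [p,q,r,s,t])"
      unfolding distinct_map using * True by (simp del: distinct.simps)
    then show ?thesis using that[OF *] by simp
  next
    case False
    then obtain p q where pq: "p \<in> I" "q \<in> I" "p \<noteq> q" "x p = x q" by (auto simp: inj_on_def)
    obtain r s t where *: "I = {p,q,r,s,t}" "distinct [p,q,r,s,t]"
      by (rule card_five_split[OF I pq(1-3)]) (rule that; assumption)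
    have **: "I = {p,q,s,r,t}" "distinct [p,q,s,r,t]" "I = {p,q,t,r,s}" "distinct [p,q,t,r,s]"
      "I = {r,s,t,p,q}" "distinct [r,s,t,p,q]"
      using *(2) by (simp_all add: *(1) eq_commute) (auto simp: insert_commute)
    have ne: "x p \<noteq> x r" "x p \<noteq> x s" "x p \<noteq> x t"
      using no3[OF *] no3[OF **(1,2)] no3[OF **(3,4)] pq by auto
    have "\<not> (x r = x s \<and> x s = x t)" using no3[OF **(5,6)] .
    then consider "x s \<noteq> x t" | "x r \<noteq> x s" by blast
    then show ?thesis
    proof cases
      case 1
      show ?thesis by (rule that[of p r q s t]) (use * 1 ne pq in auto)
    next
      case 2
      show ?thesis by (rule that[of p t q r s]) (use * 2 ne pq in auto)
    qed
  qed
qed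

section \<open>Complex Hadamard matrices of order five\<close>

lemma sum_five:
  assumes "distinct [a,b,c,d,e]"
  shows "sum f {a,b,c,d,e} = f a + f b + f c + f d + (f e :: 'b :: comm_monoid_add)"
  using assms by (simp add: add.assoc)

text \<open>\<open>Im (x * cnj y)\<close> is, up to sign, the determinant of \<open>x\<close> and
  \<open>y\<close>. They form a real basis of the plane, and \<open>Z\<close> is orthogonal to
  both.\<close>

lemma real_parallel_zero:
  fixes x y Z :: complex
  assumes "Im (x * cnj y) \<noteq> 0" "Re (Z * cnj x) = 0" "Re (Z * cnj y) = 0"
  shows "Z = 0"
proof -
  have "Re Z * Im (x * cnj y) = Re (Z * cnj y) * Im x - Re (Z * cnj x) * Im y"
    "Im Z * Im (x * cnj y) = Re (Z * cnj x) * Re y - Re (Z * cnj y) * Re x"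
    by (simp_all add: algebra_simps)
  hence "Re Z * Im (x * cnj y) = 0" "Im Z * Im (x * cnj y) = 0"
    unfolding assms(2,3) by simp_all
  with assms(1) show ?thesis by (simp only: complex_eq_iff mult_eq_0_iff) simp
qed

text \<open>\<open>F\<close> is a quadratic form on the three-dimensional quotient of \<open>\<real>\<^sup>5\<close> by the span of
  \<open>Re z\<close> and \<open>Im z\<close>, and the vanishing diagonal says that the conic \<open>F = 0\<close> passes through
  the images of the five unit vectors. No four of them are collinear, so such a form is unique up
  to a factor, which \<open>F a b = 0\<close> forces to be zero.\<close>

lemma conic_through_five_points:
  fixes F :: "'a \<Rightarrow> 'a \<Rightarrow> real" and z :: "'a \<Rightarrow> complex"
  assumes I_def: "I = {a,b,c,d,e}" and dist: "distinct [a,b,c,d,e]"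
    and sym: "\<And>j k. F j k = F k j" and diag: "\<And>k. k \<in> I \<Longrightarrow> F k k = 0"
    and ker: "\<And>j. j \<in> I \<Longrightarrow> (\<Sum>k\<in>I. of_real (F j k) * z k) = 0"
    and ab: "Im (z a * cnj (z b)) \<noteq> 0" and cd: "Im (z c * cnj (z d)) \<noteq> 0"
    and de: "Im (z d * cnj (z e)) \<noteq> 0" and ce: "Im (z c * cnj (z e)) \<noteq> 0"
    and Fab: "F a b = 0"
    and j: "j \<in> I" and k: "k \<in> I"
  shows "F j k = 0"
proof -
  define s where "s j k = Im (z j * cnj (z k))" for j k
  have ss: "s k j = - s j k" "s j j = 0" for j k by (simp_all add: s_def)
  have row: "F j a * s a m + F j b * s b m + F j c * s c m + F j d * s d m + F j e * s e m = 0"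
    if "j \<in> I" for j m
  proof -
    have "Im ((\<Sum>k\<in>I. of_real (F j k) * z k) * cnj (z m)) = 0" using ker[OF that] by simp
    then show ?thesis using dist by (simp add: I_def s_def algebra_simps)
  qed
  have in_I: "a \<in> I" "b \<in> I" "c \<in> I" "d \<in> I" "e \<in> I" by (auto simp: I_def)
  note d0 = diag[OF in_I(1)] diag[OF in_I(2)] diag[OF in_I(3)] diag[OF in_I(4)] diag[OF in_I(5)]
  have nz: "s c d \<noteq> 0" "s d e \<noteq> 0" "s c e \<noteq> 0" "s a b \<noteq> 0" using ab cd de ce by (auto simp: s_def)
  have Fba: "F b a = 0" using Fab sym by metis
  \<comment> \<open>Such a row is a real linear relation between \<open>z c\<close>,
    \<open>z d\<close>, \<open>z e\<close>; by Cramer's rule it is unique up to a factor.\<close>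
  have vec: "\<exists>t. F i c = t * s d e \<and> F i d = - t * s c e \<and> F i e = t * s c d"
    if "i \<in> I" "F i a = 0" "F i b = 0" for i
  proof (intro exI conjI)
    let ?t = "F i e / s c d"
    show "F i e = ?t * s c d" using nz by simp
    have "F i d * s d c + F i e * s e c = 0" "F i c * s c d + F i e * s e d = 0"
      using row[OF that(1), of c] row[OF that(1), of d] that by (simp_all add: ss(2))
    hence "F i d * s c d = - F i e * s c e" "F i c * s c d = F i e * s d e"
      using ss(1)[of c d] ss(1)[of c e] ss(1)[of d e] by simp_all
    then show "F i c = ?t * s d e" "F i d = - ?t * s c e" using nz by (simp_all add: field_simps)
  qed
  obtain ka where ka: "F a c = ka * s d e" "F a d = - ka * s c e" "F a e = ka * s c d"
    using vec[of a] in_I Fab d0 by blast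
  obtain kb where kb: "F b c = kb * s d e" "F b d = - kb * s c e" "F b e = kb * s c d"
    using vec[of b] in_I Fba d0 by blast
  define K where "K m = ka * s a m + kb * s b m" for m
  have r: "F a m * s a n + F b m * s b n + F c m * s c n + F d m * s d n + F e m * s e n = 0"
    if "m \<in> I" for m n using row[OF that, of n] by (simp add: sym[of _ m])
  have sw: "F d c = F c d" "F e c = F c e" "F e d = F d e" using sym by auto
  \<comment> \<open>Two rows, each contracted with \<open>z e\<close>, give both the sum and the
    difference of \<open>K e\<close> and \<open>F c d\<close>. The next two blocks repeat this for
    \<open>d\<close> and \<open>c\<close>.\<close>
  have Ke: "K e = 0 \<and> F c d = 0"
  proof -
    have "s d e * (K e + F c d) = 0" "s c e * (F c d - K e) = 0"
      using r[OF in_I(3), of e] r[OF in_I(4), of e]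
      by (simp_all add: ka kb d0 sw ss(2) K_def algebra_simps)
    thus ?thesis using nz by auto
  qed
  have Kd: "K d = 0 \<and> F c e = 0"
  proof -
    have "s d e * (K d - F c e) = 0" "s c d * (K d + F c e) = 0"
      using r[OF in_I(3), of d] r[OF in_I(5), of d] ss(1)[of d e] ss(1)[of c d]
      by (simp_all add: ka kb d0 sw ss(2) K_def algebra_simps)
    thus ?thesis using nz by auto
  qed
  have Kc: "K c = 0 \<and> F d e = 0"
  proof -
    have "s c e * (K c + F d e) = 0" "s c d * (K c - F d e) = 0"
      using r[OF in_I(4), of c] r[OF in_I(5), of c] ss(1)[of c e] ss(1)[of c d]
      by (simp_all add: ka kb d0 sw ss(2) K_def algebra_simps)
    thus ?thesis using nz by auto
  qed
  \<comment> \<open>The factor \<open>\<i>\<close> turns the determinants \<open>K m\<close> into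
    real inner products up to sign. Then \<open>Z = 0\<close>, and independence of
    \<open>z a\<close>, \<open>z b\<close> kills \<open>ka\<close> and \<open>kb\<close>.\<close>
  define Z where "Z = \<i> * (of_real ka * z a + of_real kb * z b)"
  have "Re (Z * cnj (z c)) = 0" "Re (Z * cnj (z d)) = 0"
    using Kc Kd by (simp_all add: Z_def K_def s_def algebra_simps)
  hence "Z = 0" using real_parallel_zero cd by blast
  hence "of_real ka * z a + of_real kb * z b = 0" by (simp add: Z_def)
  hence "Im ((of_real ka * z a + of_real kb * z b) * cnj (z a)) = 0"
    "Im ((of_real ka * z a + of_real kb * z b) * cnj (z b)) = 0" by simp_all
  hence "kb * s b a = 0" "ka * s a b = 0" by (simp_all add: s_def algebra_simps)
  hence "ka = 0" "kb = 0" using nz ss(1)[of a b] by auto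
  with ka kb Kc Kd Ke Fab Fba d0 sym j k show ?thesis unfolding I_def by (auto; metis mult_zero_left neg_0_equal_iff_equal)
qed

text \<open>A real combination of the rows \<open>(u k, v k, w k)\<close> that is isotropic for the form but has a
  nonzero first entry is a multiple of the first unit vector. Hence all \<open>u j * cnj (u k)\<close> are real,
  \<open>v k * w k\<close> is a fixed multiple of \<open>(u k)\<^sup>2\<close>, and the squares reduce to
  \<open>orth\<close>.\<close>

lemma squares_orthogonal_if_axis_in_span:
  fixes u v w :: "'a \<Rightarrow> complex" and c :: "'a \<Rightarrow> real"
  assumes norm: "\<And>k. k \<in> I \<Longrightarrow> norm (u k) = 1 \<and> norm (v k) = 1 \<and> norm (w k) = 1"
    and gram: "\<And>j k. j \<in> I \<Longrightarrow> k \<in> I \<Longrightarrow> Im (u j * cnj (u k) + v j * cnj (v k) + w j * cnj (w k)) = 0"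
    and form: "\<And>j k. j \<in> I \<Longrightarrow> k \<in> I \<Longrightarrow>
      \<alpha> * Re (u j * cnj (u k)) + \<beta> * Re (v j * cnj (v k)) + \<gamma> * Re (w j * cnj (w k)) = 0"
    and abc: "\<alpha> + \<beta> + \<gamma> = 0" "\<not> (\<alpha> = 0 \<and> \<beta> = 0 \<and> \<gamma> = 0)"
    and S: "S \<subseteq> I"
    and D: "of_real \<alpha> * (\<Sum>k\<in>S. of_real (c k) * u k) = 0"
           "of_real \<beta> * (\<Sum>k\<in>S. of_real (c k) * v k) = 0"
           "of_real \<gamma> * (\<Sum>k\<in>S. of_real (c k) * w k) = 0"
    and ne: "(\<Sum>k\<in>S. of_real (c k) * u k) \<noteq> 0"
    and orth: "(\<Sum>k\<in>I. v k * cnj (w k)) = 0"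
  shows "(\<Sum>k\<in>I. (v k * cnj (u k))\<^sup>2) = 0"
proof (cases "I = {}")
  case False
  then obtain i where i: "i \<in> I" by blast
  have \<alpha>: "\<alpha> = 0" using D(1) ne by simp
  have \<beta>: "\<gamma> = - \<beta>" "\<beta> \<noteq> 0" using abc \<alpha> by auto
  define u0 where "u0 = (\<Sum>k\<in>S. of_real (c k) * u k)"
  have vw0: "(\<Sum>k\<in>S. of_real (c k) * v k) = 0" "(\<Sum>k\<in>S. of_real (c k) * w k) = 0"
    using D \<beta> by auto
  \<comment> \<open>This is the inner product of row \<open>j\<close> with the combination
    (\<open>u0\<close>, 0, 0), real because the coefficients \<open>c k\<close> are.\<close>
  have u0: "Im (u j * cnj u0) = 0" if j: "j \<in> I" for j
  proof -
    have "u j * cnj u0 = u j * cnj u0 + v j * cnj (\<Sum>k\<in>S. of_real (c k) * v k)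
        + w j * cnj (\<Sum>k\<in>S. of_real (c k) * w k)"
      using vw0 by simp
    also have "\<dots> = (\<Sum>k\<in>S. of_real (c k) *
        (u j * cnj (u k) + v j * cnj (v k) + w j * cnj (w k)))"
      by (simp add: u0_def sum_distrib_left sum.distrib algebra_simps)
    also have "Im \<dots> = (\<Sum>k\<in>S. c k * Im (u j * cnj (u k) + v j * cnj (v k) + w j * cnj (w k)))"
      by simp
    also have "\<dots> = 0" using gram[OF j] S by (intro sum.neutral) auto
    finally show ?thesis .
  qed
  have real: "Im (u j * cnj (u k)) = 0" if "j \<in> I" "k \<in> I" for j k
  proof -
    have "(u j * cnj (u k)) * (u0 * cnj u0) = (u j * cnj u0) * cnj (u k * cnj u0)"
      by (simp add: mult_ac)
    moreover have "u j * cnj u0 \<in> \<real>" "u k * cnj u0 \<in> \<real>"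
      using u0 that by (simp_all only: complex_is_Real_iff)
    hence "(u j * cnj u0) * (u k * cnj u0) \<in> \<real>" "cnj (u k * cnj u0) = u k * cnj u0"
      by (blast intro: Reals_mult, simp only: Reals_cnj_iff)
    ultimately have "(u j * cnj (u k)) * (u0 * cnj u0) \<in> \<real>" by (simp only:)
    hence "Im ((u j * cnj (u k)) * of_real ((norm u0)\<^sup>2)) = 0"
      by (simp only: complex_norm_square complex_is_Real_iff)
    then show ?thesis using ne by (simp add: u0_def)
  qed
  have sq: "(u k)\<^sup>2 = (u i)\<^sup>2" if k: "k \<in> I" for k
  proof -
    have "u k * cnj (u i) = cnj (u k * cnj (u i))"
      using real[OF k i] by (simp add: complex_eq_iff)
    hence "u k * cnj (u i) * (u k * u i) = cnj (u k) * u i * (u k * u i)" by simp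
    hence "(u k)\<^sup>2 * (u i * cnj (u i)) = (u i)\<^sup>2 * (u k * cnj (u k))"
      by (simp add: power2_eq_square mult_ac)
    then show ?thesis using cnj_mult_unit norm i k by simp
  qed
  \<comment> \<open>With \<alpha> = 0, \<open>form\<close> equates the real parts and
    \<open>gram\<close> makes the imaginary parts opposite, so the quotients of \<open>v\<close> and
    of \<open>w\<close> are conjugate.\<close>
  have vw: "v k * w k = v i * w i" if k: "k \<in> I" for k
  proof -
    have "\<beta> * (Re (v k * cnj (v i)) - Re (w k * cnj (w i))) = 0"
      using form[OF k i] \<alpha> \<beta> by (simp add: algebra_simps)
    hence "Re (v k * cnj (v i)) = Re (w k * cnj (w i))" using \<beta> by simp
    moreover have "Im (v k * cnj (v i)) + Im (w k * cnj (w i)) = 0"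
      using gram[OF k i] real[OF k i] by simp
    ultimately have "v k * cnj (v i) = cnj (w k * cnj (w i))"
      by (simp add: complex_eq_iff)
    hence "v k * cnj (v i) * (v i * w k) = cnj (w k) * w i * (v i * w k)" by simp
    hence "v k * w k * (v i * cnj (v i)) = v i * w i * (w k * cnj (w k))"
      by (simp add: mult_ac)
    then show ?thesis using cnj_mult_unit norm i k by simp
  qed
  define \<kappa> where "\<kappa> = v i * w i * cnj ((u i)\<^sup>2)"
  have "(v k * cnj (u k))\<^sup>2 = \<kappa> * (v k * cnj (w k))" if k: "k \<in> I" for k
  proof -
    have "\<kappa> = v k * w k * cnj ((u k)\<^sup>2)" using sq[OF k] vw[OF k] by (simp add: \<kappa>_def)
    hence "\<kappa> * (v k * cnj (w k)) = (v k * cnj (u k))\<^sup>2 * (w k * cnj (w k))"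
      by (simp add: power2_eq_square mult_ac)
    then show ?thesis using cnj_mult_unit norm k by simp
  qed
  hence "(\<Sum>k\<in>I. (v k * cnj (u k))\<^sup>2) = \<kappa> * (\<Sum>k\<in>I. v k * cnj (w k))"
    by (simp add: sum_distrib_left)
  then show ?thesis using orth by simp
qed simp

text \<open>Pairing the relation with \<open>u\<close> over \<open>I\<close> leaves \<open>A\<close>
  times the cardinality of \<open>I\<close>.\<close>

lemma frame_coefficient_zero:
  fixes u v w :: "'a \<Rightarrow> complex"
  assumes I: "finite I" "I \<noteq> {}" and u1: "\<And>k. k \<in> I \<Longrightarrow> norm (u k) = 1"
    and comb: "\<And>j. j \<in> I \<Longrightarrow> A * cnj (u j) + B * cnj (v j) + C * cnj (w j) = 0"
    and orth: "(\<Sum>k\<in>I. u k * cnj (v k)) = 0" "(\<Sum>k\<in>I. u k * cnj (w k)) = 0"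
  shows "A = 0"
proof -
  have "0 = (\<Sum>k\<in>I. u k * (A * cnj (u k) + B * cnj (v k) + C * cnj (w k)))" using comb by simp
  also have "\<dots> = (\<Sum>k\<in>I. A * (u k * cnj (u k)) + B * (u k * cnj (v k)) + C * (u k * cnj (w k)))"
    by (intro sum.cong) (auto simp: algebra_simps)
  also have "\<dots> = A * (\<Sum>k\<in>I. u k * cnj (u k))"
    using orth by (simp add: sum.distrib flip: sum_distrib_left)
  also have "(\<Sum>k\<in>I. u k * cnj (u k)) = of_nat (card I)"
    using u1 cnj_mult_unit by simp
  finally show ?thesis using I by simp
qed

text \<open>Normal form of a Hadamard matrix of order five: two of its rows are \<open>z\<close> and
  its conjugate. Together they contribute a real number to each inner product of columns, so the
  remaining rows \<open>u\<close>, \<open>v\<close>, \<open>w\<close> contribute a real number as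
  well.\<close>

lemma orthogonal_squares_exist:
  fixes z u v w :: "'a \<Rightarrow> complex"
  assumes I: "card I = 5"
    and nz: "\<And>k. k \<in> I \<Longrightarrow> norm (z k) = 1"
    and nrm: "\<And>k. k \<in> I \<Longrightarrow> norm (u k) = 1 \<and> norm (v k) = 1 \<and> norm (w k) = 1"
    and gram: "\<And>j k. j \<in> I \<Longrightarrow> k \<in> I \<Longrightarrow>
      u j * cnj (u k) + v j * cnj (v k) + w j * cnj (w k)
        + of_real (2 * Re (z j * cnj (z k))) = (if j = k then 5 else 0)"
    and zz: "(\<Sum>k\<in>I. (z k)\<^sup>2) = 0"
    and zu: "(\<Sum>k\<in>I. u k * z k) = 0" "(\<Sum>k\<in>I. u k * cnj (z k)) = 0"
    and zv: "(\<Sum>k\<in>I. v k * z k) = 0" "(\<Sum>k\<in>I. v k * cnj (z k)) = 0"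
    and zw: "(\<Sum>k\<in>I. w k * z k) = 0" "(\<Sum>k\<in>I. w k * cnj (z k)) = 0"
    and orth: "(\<Sum>k\<in>I. u k * cnj (v k)) = 0" "(\<Sum>k\<in>I. u k * cnj (w k)) = 0"
      "(\<Sum>k\<in>I. v k * cnj (w k)) = 0"
  shows "(\<Sum>k\<in>I. (v k * cnj (u k))\<^sup>2) = 0 \<or> (\<Sum>k\<in>I. (u k * cnj (v k))\<^sup>2) = 0
    \<or> (\<Sum>k\<in>I. (u k * cnj (w k))\<^sup>2) = 0"
proof -
  have parallel: "Im (z j * cnj (z k)) \<noteq> 0" if "j \<in> I" "k \<in> I" "(z j)\<^sup>2 \<noteq> (z k)\<^sup>2" for j k
  proof
    assume "Im (z j * cnj (z k)) = 0"
    hence "z j * cnj (z k) = cnj (z j * cnj (z k))" by (simp add: complex_eq_iff)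
    hence "z j * cnj (z k) * (z j * z k) = cnj (z j) * z k * (z j * z k)" by simp
    hence "(z j)\<^sup>2 * (z k * cnj (z k)) = (z k)\<^sup>2 * (z j * cnj (z j))"
      by (simp add: power2_eq_square mult_ac)
    thus False using cnj_mult_unit nz that by simp
  qed
  obtain a b c d e where lab: "I = {a,b,c,d,e}" and dist: "distinct [a,b,c,d,e]"
    and ne: "(z a)\<^sup>2 \<noteq> (z b)\<^sup>2" "(z c)\<^sup>2 \<noteq> (z d)\<^sup>2" "(z d)\<^sup>2 \<noteq> (z e)\<^sup>2" "(z c)\<^sup>2 \<noteq> (z e)\<^sup>2"
  proof (rule labelling_of_zero_sum[OF I _ zz])
    show "norm ((z k)\<^sup>2) = 1" if "k \<in> I" for k using nz[OF that] by (simp add: norm_power)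
  qed (rule that; assumption)
  have fin: "finite I" using lab by simp
  have in_I: "a \<in> I" "b \<in> I" "c \<in> I" "d \<in> I" "e \<in> I" by (auto simp: lab)
  define g where "g f = Re (f a * cnj (f b))" for f :: "'a \<Rightarrow> complex"
  \<comment> \<open>The witness is, up to sign, the cross product of (1, 1, 1) and
    (\<open>g u\<close>, \<open>g v\<close>, \<open>g w\<close>), replaced by (1, -1, 0) when these
    are parallel. Sum zero kills the diagonal of \<open>H\<close> below, \<open>comb\<close> the
    real part of its entry at \<open>a\<close>, \<open>b\<close>.\<close>
  obtain \<alpha> \<beta> \<gamma> :: real where abc: "\<alpha> + \<beta> + \<gamma> = 0" "\<not> (\<alpha> = 0 \<and> \<beta> = 0 \<and> \<gamma> = 0)"
    and comb: "\<alpha> * g u + \<beta> * g v + \<gamma> * g w = 0"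
  proof (cases "g u = g v \<and> g v = g w")
    case True
    show ?thesis by (rule that[of 1 "-1" 0]) (use True in auto)
  next
    case False
    show ?thesis
      by (rule that[of "g v - g w" "g w - g u" "g u - g v"]) (use False in \<open>auto simp: algebra_simps\<close>)
  qed
  define H where "H j k = of_real \<alpha> * (u j * cnj (u k)) + of_real \<beta> * (v j * cnj (v k))
    + of_real \<gamma> * (w j * cnj (w k))" for j k
  have H_cnj: "H k j = cnj (H j k)" for j k by (simp add: H_def mult_ac)
  have cz: "(\<Sum>k\<in>I. f k * cnj (z k)) = 0 \<Longrightarrow> (\<Sum>k\<in>I. cnj (f k) * z k) = 0" for f
    by (drule arg_cong[where f = cnj]) simp
  have Hz: "(\<Sum>k\<in>I. H j k * z k) = 0" for j
  proof -
    have "(\<Sum>k\<in>I. H j k * z k) = of_real \<alpha> * u j * (\<Sum>k\<in>I. cnj (u k) * z k)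
      + of_real \<beta> * v j * (\<Sum>k\<in>I. cnj (v k) * z k) + of_real \<gamma> * w j * (\<Sum>k\<in>I. cnj (w k) * z k)"
      by (simp add: H_def sum_distrib_left sum.distrib algebra_simps)
    thus ?thesis using cz[OF zu(2)] cz[OF zv(2)] cz[OF zw(2)] by simp
  qed
  have Hz': "(\<Sum>k\<in>I. H k j * z k) = 0" for j
  proof -
    have "(\<Sum>k\<in>I. H k j * z k) = of_real \<alpha> * cnj (u j) * (\<Sum>k\<in>I. u k * z k)
      + of_real \<beta> * cnj (v j) * (\<Sum>k\<in>I. v k * z k) + of_real \<gamma> * cnj (w j) * (\<Sum>k\<in>I. w k * z k)"
      by (simp add: H_def sum_distrib_left sum.distrib algebra_simps)
    thus ?thesis using zu zv zw by simp
  qed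
  have Re_H: "Re (H j k) = 0" if "j \<in> I" "k \<in> I" for j k
  proof (rule conic_through_five_points[OF lab dist _ _ _ _ _ _ _ _ that, where F = "\<lambda>j k. Re (H j k)"])
    show "Re (H j k) = Re (H k j)" for j k by (simp only: H_cnj[of k j]) simp
    show "Re (H k k) = 0" if "k \<in> I" for k
    proof -
      have "H k k = of_real (\<alpha> + \<beta> + \<gamma>)" using nrm[OF that] by (simp add: H_def cnj_mult_unit)
      thus ?thesis using abc by simp
    qed
    show "(\<Sum>k\<in>I. of_real (Re (H j k)) * z k) = 0" for j
    proof -
      have "2 * of_real (Re (H j k)) = H j k + H k j" for k
        by (simp only: H_cnj[of k j]) (simp add: complex_eq_iff)
      hence "2 * (\<Sum>k\<in>I. of_real (Re (H j k)) * z k) = (\<Sum>k\<in>I. H j k * z k) + (\<Sum>k\<in>I. H k j * z k)"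
        by (simp add: sum_distrib_left distrib_right flip: sum.distrib mult.assoc)
      thus ?thesis using Hz Hz' by simp
    qed
    show "Re (H a b) = 0" using comb by (simp add: H_def g_def)
  qed (rule parallel; fact)+
  define R where "R j k = Im (H j k)" for j k
  have HR: "H j k = \<i> * of_real (R j k)" if "j \<in> I" "k \<in> I" for j k
    using Re_H[OF that] by (simp add: R_def complex_eq_iff)
  have R_anti: "R k j = - R j k" for j k using H_cnj[of k j] by (simp add: R_def)
  have R_diag: "R k k = 0" for k using R_anti[of k k] by simp
  \<comment> \<open>The antisymmetric 3 by 3 block of \<open>R\<close> on \<open>c\<close>,
    \<open>d\<close>, \<open>e\<close> has the kernel vector (\<open>R d e\<close>,
    \<open>R e c\<close>, \<open>R c d\<close>). If this is zero the block vanishes, and the unit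
    vector at \<open>c\<close> is taken instead.\<close>
  define nul where "nul = (R d e = 0 \<and> R e c = 0 \<and> R c d = 0)"
  define x where "x k = (if k = c then (if nul then 1 else R d e) else if k = d then R e c
    else if k = e then R c d else 0)" for k
  have x_ne: "\<exists>k\<in>I. x k \<noteq> 0"
    using dist in_I by (cases "R d e = 0"; cases "R e c = 0"; cases "R c d = 0") (auto simp: x_def nul_def)
  have x_ab: "x a = 0" "x b = 0" using dist by (auto simp: x_def)
  have x_sum: "(\<Sum>k\<in>I. of_real (x k) * f k) = of_real (x c) * f c + of_real (x d) * f d + of_real (x e) * f e"
    for f :: "'a \<Rightarrow> complex" using x_ab by (simp only: lab sum_five[OF dist]) simp
  have xR: "x c * R c j + x d * R d j + x e * R e j = 0" if "j \<in> {c,d,e}" for j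
    using dist that R_anti[of d c] R_anti[of e c] R_anti[of e d] R_anti[of c e]
    by (cases nul) (auto simp: x_def R_diag nul_def)
  define u0 v0 w0 where "u0 = (\<Sum>k\<in>I. of_real (x k) * u k)" and "v0 = (\<Sum>k\<in>I. of_real (x k) * v k)"
    and "w0 = (\<Sum>k\<in>I. of_real (x k) * w k)"
  define t where "t j = (\<Sum>k\<in>I. of_real (x k) * H k j)" for j
  have t_eq: "t j = of_real \<alpha> * u0 * cnj (u j) + of_real \<beta> * v0 * cnj (v j) + of_real \<gamma> * w0 * cnj (w j)" for j
    by (simp add: t_def u0_def v0_def w0_def H_def sum_distrib_left sum_distrib_right sum.distrib algebra_simps)
  have t_cde: "t j = 0" if "j \<in> {c,d,e}" for j
  proof -
    have j: "j \<in> I" using that lab by auto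
    have "t j = \<i> * of_real (x c * R c j + x d * R d j + x e * R e j)"
      unfolding t_def x_sum using HR in_I j by (simp add: algebra_simps)
    thus ?thesis using xR[OF that] by simp
  qed
  have tz: "(\<Sum>j\<in>I. t j * f j) = (\<Sum>k\<in>I. of_real (x k) * (\<Sum>j\<in>I. H k j * f j))" for f
    unfolding t_def sum_distrib_left sum_distrib_right by (subst sum.swap) (simp add: mult_ac)
  have Hzc: "(\<Sum>j\<in>I. H k j * cnj (z j)) = 0" for k
  proof -
    have "(\<Sum>j\<in>I. H k j * cnj (z j)) = cnj (\<Sum>j\<in>I. H j k * z j)"
      by (simp add: H_cnj[of k])
    thus ?thesis using Hz' by simp
  qed
  \<comment> \<open>Orthogonality to \<open>z\<close> and its conjugate is a regular 2 by 2 system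
    for the two remaining entries \<open>t a\<close> and \<open>t b\<close>.\<close>
  have "(\<Sum>j\<in>I. t j * z j) = 0" "(\<Sum>j\<in>I. t j * cnj (z j)) = 0"
    unfolding tz using Hz Hzc by simp_all
  hence tab: "t a * z a + t b * z b = 0" "t a * cnj (z a) + t b * cnj (z b) = 0"
    using t_cde by (simp_all add: lab sum_five[OF dist] del: distinct.simps)
  have "t j = 0" if "j \<in> I" for j
  proof -
    have det: "z a * cnj (z b) - z b * cnj (z a) \<noteq> 0"
      using parallel[OF in_I(1,2) ne(1)] by (auto simp: complex_eq_iff)
    have "t a * (z a * cnj (z b) - z b * cnj (z a)) = 0" "t b * (z a * cnj (z b) - z b * cnj (z a)) = 0"
      using tab by algebra+
    hence "t a = 0" "t b = 0" using det by auto
    thus ?thesis using t_cde that lab by auto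
  qed
  note t0 = this
  have D: "of_real \<alpha> * u0 = 0" "of_real \<beta> * v0 = 0" "of_real \<gamma> * w0 = 0"
  proof -
    have co: "(\<Sum>k\<in>I. f k * cnj (h k)) = 0 \<Longrightarrow> (\<Sum>k\<in>I. h k * cnj (f k)) = 0" for f h
      by (drule arg_cong[where f = cnj]) (simp add: mult.commute)
    have I': "finite I" "I \<noteq> {}" using lab by auto
    have comb: "of_real \<alpha> * u0 * cnj (u j) + of_real \<beta> * v0 * cnj (v j) + of_real \<gamma> * w0 * cnj (w j) = 0"
      if "j \<in> I" for j using t0[OF that] t_eq[of j] by simp
    show "of_real \<alpha> * u0 = 0"
      by (rule frame_coefficient_zero[OF I' _ comb orth(1,2)]) (use nrm in auto)
    have "of_real \<beta> * v0 * cnj (v j) + of_real \<alpha> * u0 * cnj (u j) + of_real \<gamma> * w0 * cnj (w j) = 0"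
      if "j \<in> I" for j using comb[OF that] by (simp only: add_ac)
    from frame_coefficient_zero[OF I' _ this co[OF orth(1)] orth(3)]
    show "of_real \<beta> * v0 = 0" using nrm by blast
    have "of_real \<gamma> * w0 * cnj (w j) + of_real \<alpha> * u0 * cnj (u j) + of_real \<beta> * v0 * cnj (v j) = 0"
      if "j \<in> I" for j using comb[OF that] by (simp only: add_ac)
    from frame_coefficient_zero[OF I' _ this co[OF orth(2)] co[OF orth(3)]]
    show "of_real \<gamma> * w0 = 0" using nrm by blast
  qed
  \<comment> \<open>If all three vanished, \<open>gram\<close> would leave 2
    Re(\<open>Z * cnj (z j)\<close>) = 5 \<open>x j\<close>. Since \<open>x\<close> is zero at
    \<open>a\<close> and \<open>b\<close>, this forces \<open>Z = 0\<close> and then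
    \<open>x = 0\<close>.\<close>
  have "\<not> (u0 = 0 \<and> v0 = 0 \<and> w0 = 0)"
  proof
    assume 0: "u0 = 0 \<and> v0 = 0 \<and> w0 = 0"
    define Z where "Z = (\<Sum>k\<in>I. of_real (x k) * z k)"
    have xj: "2 * Re (Z * cnj (z j)) = 5 * x j" if j: "j \<in> I" for j
    proof -
      have P: "(\<Sum>k\<in>I. of_real (x k) * (f k * y)) = (\<Sum>k\<in>I. of_real (x k) * f k) * y" for f y
        by (simp add: sum_distrib_right mult.assoc)
      have "2 * Re (Z * cnj (z j)) = (\<Sum>k\<in>I. x k * (2 * Re (z k * cnj (z j))))"
        by (simp add: Z_def sum_distrib_right sum_distrib_left sum.distrib algebra_simps)
      hence Q: "(\<Sum>k\<in>I. of_real (x k) * of_real (2 * Re (z k * cnj (z j)))) = of_real (2 * Re (Z * cnj (z j)))"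
        by (simp only: of_real_sum of_real_mult)
      have "complex_of_real (5 * x j) = (\<Sum>k\<in>I. of_real (x k) * (if k = j then 5 else 0))"
        using j fin by (simp add: if_distrib[of "\<lambda>y. _ * y"] mult.commute cong: if_cong)
      also have "\<dots> = (\<Sum>k\<in>I. of_real (x k) * (u k * cnj (u j) + v k * cnj (v j) + w k * cnj (w j)
        + of_real (2 * Re (z k * cnj (z j)))))"
        using gram[OF _ j] by (intro sum.cong refl) simp
      also have "\<dots> = u0 * cnj (u j) + v0 * cnj (v j) + w0 * cnj (w j) + of_real (2 * Re (Z * cnj (z j)))"
        unfolding distrib_left sum.distrib P Q u0_def v0_def w0_def ..
      also have "\<dots> = of_real (2 * Re (Z * cnj (z j)))" using 0 by simp
      finally show ?thesis by (simp only: of_real_eq_iff)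
    qed
    have "Z = 0" using xj[OF in_I(1)] xj[OF in_I(2)] x_ab
      by (intro real_parallel_zero[OF parallel[OF in_I(1,2) ne(1)]]) simp_all
    with xj x_ne show False by auto
  qed
  have im: "Im (u j * cnj (u k)) + Im (v j * cnj (v k)) + Im (w j * cnj (w k)) = 0"
    if "j \<in> I" "k \<in> I" for j k
    using arg_cong[OF gram[OF that], of Im] by (cases "j = k") (simp_all add: R_diag)
  have re: "\<alpha> * Re (u j * cnj (u k)) + \<beta> * Re (v j * cnj (v k)) + \<gamma> * Re (w j * cnj (w k)) = 0"
    if "j \<in> I" "k \<in> I" for j k
    using Re_H[OF that] by (simp add: H_def)
  from \<open>\<not> (u0 = 0 \<and> v0 = 0 \<and> w0 = 0)\<close> consider "u0 \<noteq> 0" | "v0 \<noteq> 0" | "w0 \<noteq> 0" by blast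
  then show ?thesis
  proof cases
    case 1
    have "(\<Sum>k\<in>I. (v k * cnj (u k))\<^sup>2) = 0"
      by (rule squares_orthogonal_if_axis_in_span[OF _ _ _ abc subset_refl, where c = x and w = w])
        (use nrm im re D orth 1 in \<open>simp_all only: u0_def v0_def w0_def plus_complex.sel simp_thms\<close>)
    then show ?thesis by blast
  next
    case 2
    have "(\<Sum>k\<in>I. (u k * cnj (v k))\<^sup>2) = 0"
      by (rule squares_orthogonal_if_axis_in_span[OF _ _ _ _ _ subset_refl,
            where c = x and w = w and \<alpha> = \<beta> and \<beta> = \<alpha> and \<gamma> = \<gamma>])
        (use nrm im re D orth 2 abc in \<open>simp_all only: u0_def v0_def w0_def plus_complex.sel add_ac conj_ac simp_thms\<close>)
    then show ?thesis by blast
  next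
    case 3
    have "(\<Sum>k\<in>I. (u k * cnj (w k))\<^sup>2) = 0"
      by (rule squares_orthogonal_if_axis_in_span[OF _ _ _ _ _ subset_refl,
            where c = x and w = v and \<alpha> = \<gamma> and \<beta> = \<alpha> and \<gamma> = \<beta>])
        (use nrm im re D orth 3 abc in \<open>simp_all only: u0_def v0_def w0_def plus_complex.sel add_ac conj_ac simp_thms\<close>)
    then show ?thesis by blast
  qed
qed

text \<open>Dividing column \<open>k\<close> by a square root \<open>\<sigma> k\<close> of
  \<open>h p k * h q k\<close> makes rows \<open>p\<close> and \<open>q\<close> conjugate to each
  other. Products of one row with the conjugate of another are unchanged, so the normal form
  applies.\<close>

lemma hadamard_five_squares_orthogonal:
  fixes h :: "'b \<Rightarrow> 'a \<Rightarrow> complex"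
  assumes L: "card L = 5" and I: "card I = 5"
    and nrm: "\<And>l k. norm (h l k) = 1"
    and col: "\<And>l m. l \<in> L \<Longrightarrow> m \<in> L \<Longrightarrow> l \<noteq> m \<Longrightarrow> (\<Sum>k\<in>I. h l k * cnj (h m k)) = 0"
    and row: "\<And>j k. j \<in> I \<Longrightarrow> k \<in> I \<Longrightarrow> (\<Sum>l\<in>L. h l j * cnj (h l k)) = (if j = k then 5 else 0)"
  obtains l m where "l \<in> L" "m \<in> L" "l \<noteq> m" "(\<Sum>k\<in>I. (h l k * cnj (h m k))\<^sup>2) = 0"
proof -
  obtain p q r s t where LL: "L = {p,q,r,s,t}" "distinct [p,q,r,s,t]"
  proof -
    have "finite L" "\<not> card L \<le> Suc 0" using L by (auto intro: card_ge_0_finite)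
    then obtain p q where "p \<in> L" "q \<in> L" "p \<noteq> q" using card_le_Suc0_iff_eq by blast
    then show ?thesis by (rule card_five_split[OF L]) (rule that; assumption)
  qed
  have colp: "(\<Sum>k\<in>I. h r k * cnj (h p k)) = 0" "(\<Sum>k\<in>I. h s k * cnj (h p k)) = 0"
    "(\<Sum>k\<in>I. h t k * cnj (h p k)) = 0" "(\<Sum>k\<in>I. h r k * cnj (h q k)) = 0"
    "(\<Sum>k\<in>I. h s k * cnj (h q k)) = 0" "(\<Sum>k\<in>I. h t k * cnj (h q k)) = 0"
    "(\<Sum>k\<in>I. h p k * cnj (h q k)) = 0" "(\<Sum>k\<in>I. h r k * cnj (h s k)) = 0"
    "(\<Sum>k\<in>I. h r k * cnj (h t k)) = 0" "(\<Sum>k\<in>I. h s k * cnj (h t k)) = 0"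
    using LL by (auto intro!: col)
  define \<sigma> where "\<sigma> k = csqrt (h p k * h q k)" for k
  have \<sigma>2: "\<sigma> k * \<sigma> k = h p k * h q k" for k
    by (simp add: \<sigma>_def flip: power2_eq_square)
  have n\<sigma>: "norm (\<sigma> k) = 1" for k
  proof -
    have "(norm (\<sigma> k))\<^sup>2 = 1" using arg_cong[OF \<sigma>2[of k], of norm] nrm
      by (simp add: norm_mult power2_eq_square)
    thus ?thesis using norm_ge_zero[of "\<sigma> k"] by (auto simp: power2_eq_1_iff)
  qed
  note u\<sigma> = cnj_mult_unit[OF n\<sigma>] and uh = cnj_mult_unit[OF nrm]
  define z u v w where "z k = h p k * cnj (\<sigma> k)" and "u k = h r k * cnj (\<sigma> k)"
    and "v k = h s k * cnj (\<sigma> k)" and "w k = h t k * cnj (\<sigma> k)" for k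
  have zq: "z k = cnj (h q k) * \<sigma> k" for k
    using \<sigma>2[of k] u\<sigma>[of k] uh[of q k] unfolding z_def by algebra
  have scaled: "(x * cnj (\<sigma> k)) * cnj (y * cnj (\<sigma> k)) = x * cnj y" for x y k
    using u\<sigma>[of k] by (simp add: mult.commute[of "cnj (\<sigma> k)" "\<sigma> k"])
  have scaled_q: "(x * cnj (\<sigma> k)) * z k = x * cnj (h q k)" for x k
    using u\<sigma>[of k] unfolding zq by algebra
  have "(\<Sum>k\<in>I. (v k * cnj (u k))\<^sup>2) = 0 \<or> (\<Sum>k\<in>I. (u k * cnj (v k))\<^sup>2) = 0
    \<or> (\<Sum>k\<in>I. (u k * cnj (w k))\<^sup>2) = 0"
  proof (rule orthogonal_squares_exist[OF I])
    show "u j * cnj (u k) + v j * cnj (v k) + w j * cnj (w k)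
        + of_real (2 * Re (z j * cnj (z k))) = (if j = k then 5 else 0)" if "j \<in> I" "k \<in> I" for j k
    proof -
      have "(\<Sum>l\<in>L. h l j * cnj (h l k)) * (cnj (\<sigma> j) * \<sigma> k) = (if j = k then 5 else 0)"
        using row[OF that] u\<sigma> by (simp add: mult_ac)
      moreover have "(\<Sum>l\<in>L. h l j * cnj (h l k)) * (cnj (\<sigma> j) * \<sigma> k) =
        u j * cnj (u k) + v j * cnj (v k) + w j * cnj (w k) + (z j * cnj (z k) + cnj (z j) * z k)"
      proof -
        have "cnj (z j) * z k = h q j * cnj (h q k) * (cnj (\<sigma> j) * \<sigma> k)"
          by (simp add: zq)
        moreover have "z j * cnj (z k) = h p j * cnj (h p k) * (cnj (\<sigma> j) * \<sigma> k)"
          by (simp add: z_def)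
        ultimately show ?thesis
          unfolding LL(1) sum_five[OF LL(2)] u_def v_def w_def by (simp add: algebra_simps)
      qed
      moreover have "z j * cnj (z k) + cnj (z j) * z k = of_real (2 * Re (z j * cnj (z k)))"
        by (simp add: complex_eq_iff)
      ultimately show ?thesis by simp
    qed
    show "(\<Sum>k\<in>I. (z k)\<^sup>2) = 0"
    proof -
      have "(z k)\<^sup>2 = h p k * cnj (h q k)" for k
        using scaled_q[of "h p k" k] by (simp only: power2_eq_square z_def[symmetric])
      thus ?thesis using colp by simp
    qed
    show "(\<Sum>k\<in>I. u k * z k) = 0" "(\<Sum>k\<in>I. v k * z k) = 0" "(\<Sum>k\<in>I. w k * z k) = 0"
      using colp by (simp_all only: u_def v_def w_def scaled_q)
    show "(\<Sum>k\<in>I. u k * cnj (z k)) = 0" "(\<Sum>k\<in>I. v k * cnj (z k)) = 0" "(\<Sum>k\<in>I. w k * cnj (z k)) = 0"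
      "(\<Sum>k\<in>I. u k * cnj (v k)) = 0" "(\<Sum>k\<in>I. u k * cnj (w k)) = 0" "(\<Sum>k\<in>I. v k * cnj (w k)) = 0"
      using colp by (simp_all only: u_def v_def w_def z_def scaled)
  qed (simp_all add: z_def u_def v_def w_def norm_mult nrm n\<sigma>)
  hence "(\<Sum>k\<in>I. (h s k * cnj (h r k))\<^sup>2) = 0 \<or> (\<Sum>k\<in>I. (h r k * cnj (h s k))\<^sup>2) = 0
    \<or> (\<Sum>k\<in>I. (h r k * cnj (h t k))\<^sup>2) = 0"
    unfolding u_def v_def w_def scaled .
  moreover have "r \<in> L" "s \<in> L" "t \<in> L" "r \<noteq> s" "s \<noteq> r" "r \<noteq> t" using LL by auto
  ultimately show ?thesis using that[of s r] that[of r s] that[of r t] by blast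
qed

section \<open>Tilings from characters\<close>

definition root_quot :: "nat \<Rightarrow> complex \<Rightarrow> complex" where
  "root_quot n c = c / (SOME r. r ^ n = c ^ n)"

text \<open>Only \<open>c ^ n\<close> enters the choice of \<open>r\<close>, so \<open>root_quot n\<close> maps \<open>\<complex> - {0}\<close> to the \<open>n\<close>-th roots
  of unity equivariantly. Composed with a character it replaces a choice of coset representatives.\<close>

lemma root_quot_power:
  assumes "n > 0" "c \<noteq> 0"
  shows "root_quot n c ^ n = 1"
proof -
  have "\<exists>r. r ^ n = c ^ n" by blast
  hence "(SOME r. r ^ n = c ^ n) ^ n = c ^ n" by (rule someI_ex)
  then show ?thesis using assms by (simp add: root_quot_def power_divide)
qed

lemma root_quot_mult: "d ^ n = 1 \<Longrightarrow> root_quot n (d * c) = d * root_quot n c"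
  by (simp add: root_quot_def power_mult_distrib)

text \<open>Homomorphisms to the unit circle, stated through differences because tilings evaluate
  them at \<open>x - a\<close>.\<close>

definition is_character :: "(int ^ 'd \<Rightarrow> complex) \<Rightarrow> bool" where
  "is_character \<psi> \<longleftrightarrow> (\<forall>x. norm (\<psi> x) = 1) \<and> (\<forall>x y. \<psi> (x - y) = \<psi> x * cnj (\<psi> y))"

text \<open>\<open>P\<close> describes the translation set, and \<open>a\<close> corresponds to the
  translation \<open>x - a\<close>.\<close>

lemma tilesI:
  assumes "\<And>x. \<exists>!a. a \<in> A \<and> P (x - a)"
  shows "tiles A"
  unfolding tiles_def
proof (intro exI allI)
  fix x
  obtain a where a: "a \<in> A" "P (x - a)" "\<And>b. b \<in> A \<Longrightarrow> P (x - b) \<Longrightarrow> b = a"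
    using assms[of x] by blast
  have "t = x - a" if "P t" "x - t \<in> A" for t
    using a(3)[OF that(2)] that(1) by (simp add: algebra_simps)
  moreover have "P (x - a)" "x - (x - a) \<in> A" using a(1,2) by simp_all
  ultimately have "{t \<in> {t. P t}. x - t \<in> A} = {x - a}" by blast
  then show "card {t \<in> {t. P t}. x - t \<in> A} = 1" by simp
qed

text \<open>By counting, \<open>\<psi>\<close> maps \<open>A\<close> bijectively onto the
  \<open>n\<close>-th roots of \<open>w\<close>. The translations are the \<open>t\<close> with
  \<open>root_quot n (\<psi> t) = 1\<close>; by equivariance this condition on \<open>x - a\<close>
  prescribes \<open>\<psi> a\<close> as one such root.\<close>

lemma tiles_if_roots_of_unity:
  assumes \<psi>: "is_character \<psi>" and n: "card A = n" "n > 0"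
    and inj: "inj_on \<psi> A" and pow: "\<And>a. a \<in> A \<Longrightarrow> \<psi> a ^ n = w"
  shows "tiles A"
proof (rule tilesI)
  fix x
  obtain b where b: "b \<in> A" using n by (metis all_not_in_conv card.empty less_irrefl)
  have nrm: "norm (\<psi> y) = 1" for y using \<psi> by (simp add: is_character_def)
  have diff: "\<psi> (y - z) = \<psi> y * cnj (\<psi> z)" for y z using \<psi> by (simp add: is_character_def)
  have nz: "\<psi> y \<noteq> 0" for y using nrm[of y] by auto
  have w0: "w \<noteq> 0" using pow[OF b] nz by auto
  have "\<psi> ` A = {z. z ^ n = w}"
  proof (rule card_subset_eq)
    show "finite {z. z ^ n = w}" using n(2) by (intro finite_nth_roots) auto
    show "\<psi> ` A \<subseteq> {z. z ^ n = w}" using pow by auto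
    show "card (\<psi> ` A) = card {z. z ^ n = w}"
      using card_nth_roots[OF w0] n inj by (simp add: card_image)
  qed
  have key: "root_quot n (\<psi> (x - a)) = 1 \<longleftrightarrow> \<psi> a = \<psi> b * root_quot n (\<psi> (x - b))"
    if a: "a \<in> A" for a
  proof -
    have "\<psi> (x - a) = \<psi> b * cnj (\<psi> a) * \<psi> (x - b)"
      using cnj_mult_unit[OF nrm[of b]] by (simp add: diff mult_ac)
    moreover have "(\<psi> b * cnj (\<psi> a)) ^ n = 1"
    proof -
      have "(\<psi> b * cnj (\<psi> a)) ^ n = w * cnj w"
        using pow[OF a] pow[OF b] by (simp add: power_mult_distrib flip: complex_cnj_power)
      also have "norm w = 1" using pow[OF b] nrm by (metis norm_power power_one)
      hence "w * cnj w = 1" by (rule cnj_mult_unit)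
      finally show ?thesis .
    qed
    ultimately have "root_quot n (\<psi> (x - a)) = \<psi> b * cnj (\<psi> a) * root_quot n (\<psi> (x - b))"
      by (simp add: root_quot_mult)
    also have "\<dots> = 1 \<longleftrightarrow> \<psi> a = \<psi> b * root_quot n (\<psi> (x - b))"
      using nz[of a] unfolding unit_inverse[OF nrm[of a], symmetric] by (auto simp: field_simps)
    finally show ?thesis .
  qed
  have "(\<psi> b * root_quot n (\<psi> (x - b))) ^ n = w"
    using root_quot_power[OF n(2) nz] pow[OF b] by (simp add: power_mult_distrib)
  then have "\<exists>a\<in>A. \<psi> a = \<psi> b * root_quot n (\<psi> (x - b))"
    using \<open>\<psi> ` A = _\<close> by (metis (mono_tags, lifting) imageE mem_Collect_eq)
  then show "\<exists>!a. a \<in> A \<and> root_quot n (\<psi> (x - a)) = 1"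
    using key inj by (metis inj_onD)
qed

text \<open>The translations are those where both signs \<open>f\<close>, \<open>g\<close> are 1:
  the sign from \<open>\<phi>\<close> selects one of the pairs {a, b} and {c, d}, the sign from
  \<open>\<psi>\<close> an element of it.\<close>

lemma tiles_if_two_pairs:
  assumes \<phi>: "is_character \<phi>" and \<psi>: "is_character \<psi>"
    and A: "A = {a,b,c,d}"
    and P: "\<phi> b = \<phi> a" "\<phi> c = - \<phi> a" "\<phi> d = - \<phi> a"
    and Q: "\<psi> b = - \<psi> a" "\<psi> d = - \<psi> c"
  shows "tiles A"
proof -
  define f g where "f x = root_quot 2 (\<phi> x)" and "g x = root_quot 2 (\<psi> x)" for x
  have neg: "root_quot 2 (- y) = - root_quot 2 y" for y
    using root_quot_mult[of "-1" 2 y] by simp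
  have pm: "root_quot 2 (\<eta> x) = 1 \<or> root_quot 2 (\<eta> x) = -1" if "is_character \<eta>" for \<eta> :: "int ^ 'a \<Rightarrow> complex" and x
  proof -
    have "\<eta> x \<noteq> 0" using that by (metis is_character_def norm_zero zero_neq_one)
    from root_quot_power[OF _ this, of 2] show ?thesis by (simp add: power2_eq_1_iff)
  qed
  have f: "f (x - b) = f (x - a)" "f (x - c) = - f (x - a)" "f (x - d) = - f (x - a)" for x
    using \<phi> P by (simp_all add: f_def is_character_def neg)
  have g: "g (x - b) = - g (x - a)" "g (x - d) = - g (x - c)" for x
    using \<psi> Q by (simp_all add: g_def is_character_def neg)
  show ?thesis
  proof (rule tilesI)
    fix x
    have fx: "f (x - a) = 1 \<or> f (x - a) = -1" and gx: "g (x - a) = 1 \<or> g (x - a) = -1"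
      "g (x - c) = 1 \<or> g (x - c) = -1" using pm \<phi> \<psi> by (simp_all add: f_def g_def)
    from fx show "\<exists>!y. y \<in> A \<and> (f (x - y) = 1 \<and> g (x - y) = 1)"
    proof
      assume "f (x - a) = 1"
      then show ?thesis using gx(1) f[of x] g[of x] by (auto simp: A)
    next
      assume "f (x - a) = -1"
      then show ?thesis using gx(2) f[of x] g[of x] by (auto simp: A)
    qed
  qed
qed

section \<open>Quotients of characters and four-element sets\<close>

lemma is_character_mult_cnj:
  assumes "is_character \<phi>" "is_character \<psi>"
  shows "is_character (\<lambda>x. \<phi> x * cnj (\<psi> x))"
  using assms by (simp add: is_character_def norm_mult)

lemma is_character_cnj: "is_character \<psi> \<Longrightarrow> is_character (\<lambda>x. cnj (\<psi> x))"
  by (simp add: is_character_def)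

lemma is_character_character: "is_character (character l)"
proof -
  have cis: "character l x = cis (2 * pi * (\<Sum>i\<in>UNIV. l $ i * real_of_int (x $ i)))" for x
    by (simp add: character_def cis_conv_exp mult_ac)
  show ?thesis
    by (simp add: is_character_def cis cis_cnj cis_mult sum_subtractf algebra_simps)
qed

text \<open>The quotient of \<open>\<phi>\<close> and \<open>\<psi>\<close> is constant on each
  pair, and orthogonality makes the two constants opposite. It separates the pairs, and
  \<open>\<phi>\<close> separates each pair.\<close>

lemma tiles_if_same_pairing:
  assumes \<phi>: "is_character \<phi>" and \<psi>: "is_character \<psi>"
    and A: "A = {a,b,c,d}" "distinct [a,b,c,d]"
    and P: "\<phi> b = - \<phi> a" "\<phi> d = - \<phi> c"
    and Q: "\<psi> b = - \<psi> a" "\<psi> d = - \<psi> c"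
    and orth: "(\<Sum>x\<in>A. \<phi> x * cnj (\<psi> x)) = 0"
  shows "tiles A"
proof (rule tiles_if_two_pairs[OF is_character_mult_cnj[OF \<phi> \<psi>] \<phi> A(1) _ _ _ P])
  have "2 * (\<phi> c * cnj (\<psi> c)) + 2 * (\<phi> a * cnj (\<psi> a)) = 0"
    using orth A P Q by (simp add: algebra_simps)
  hence "2 * (\<phi> c * cnj (\<psi> c) + \<phi> a * cnj (\<psi> a)) = 0" by (simp only: distrib_left)
  hence "\<phi> c * cnj (\<psi> c) + \<phi> a * cnj (\<psi> a) = 0"
    by (simp only: mult_eq_0_iff zero_neq_numeral[symmetric] simp_thms)
  thus c: "\<phi> c * cnj (\<psi> c) = - (\<phi> a * cnj (\<psi> a))" by (simp only: eq_neg_iff_add_eq_0)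
  show "\<phi> d * cnj (\<psi> d) = - (\<phi> a * cnj (\<psi> a))" using c P Q by simp
qed (use P Q in simp)

text \<open>Each of \<open>\<phi>\<close>, \<open>\<psi>\<close> and their quotient splits
  \<open>A\<close> into antipodal pairs. Either two of the splittings agree, or all three differ and
  \<open>\<psi>\<close> is forced to take opposite values at \<open>a\<close> and \<open>b\<close>
  or to be constant on the pairs of \<open>\<phi>\<close>.\<close>

lemma tiles_four:
  assumes \<phi>: "is_character \<phi>" and \<psi>: "is_character \<psi>" and card: "card A = 4"
    and s\<phi>: "(\<Sum>x\<in>A. \<phi> x) = 0" and s\<psi>: "(\<Sum>x\<in>A. \<psi> x) = 0"
    and orth: "(\<Sum>x\<in>A. \<phi> x * cnj (\<psi> x)) = 0"
  shows "tiles A"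
proof -
  have nrm: "norm (\<eta> x) = 1" if "is_character \<eta>" for \<eta> :: "int ^ 'a \<Rightarrow> complex" and x
    using that by (simp add: is_character_def)
  obtain a b c d where A: "A = {a,b,c,d}" "distinct [a,b,c,d]"
    using card by (auto simp: card_Suc_eq eval_nat_numeral)
  have sum4: "sum f A = f a + f b + f c + f d" for f :: "int ^ 'a \<Rightarrow> complex"
    using A by (simp add: add.assoc)
  have pairing: "\<eta> b = - \<eta> a \<and> \<eta> d = - \<eta> c \<or> \<eta> c = - \<eta> a \<and> \<eta> d = - \<eta> b \<or> \<eta> d = - \<eta> a \<and> \<eta> c = - \<eta> b"
    if "is_character \<eta>" "sum \<eta> A = 0" for \<eta> :: "int ^ 'a \<Rightarrow> complex"
    by (rule zero_sum_four_antipodal) (use that nrm in \<open>simp_all add: sum4\<close>)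
  have main: "tiles A" if A: "A = {a,b,c,d}" "distinct [a,b,c,d]"
    and \<phi>ab: "\<phi> b = - \<phi> a" "\<phi> d = - \<phi> c" and \<psi>ac: "\<psi> c = - \<psi> a" "\<psi> d = - \<psi> b" for a b c d
  proof -
    have sum4: "sum f A = f a + f b + f c + f d" for f :: "int ^ 'a \<Rightarrow> complex"
      using A by (simp add: add.assoc)
    define \<rho> where "\<rho> x = \<phi> x * cnj (\<psi> x)" for x
    have \<rho>_char: "is_character \<rho>" using is_character_mult_cnj[OF \<phi> \<psi>] by (simp add: \<rho>_def[abs_def])
    have "\<rho> b = - \<rho> a \<and> \<rho> d = - \<rho> c \<or> \<rho> c = - \<rho> a \<and> \<rho> d = - \<rho> b \<or> \<rho> d = - \<rho> a \<and> \<rho> c = - \<rho> b"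
      by (rule zero_sum_four_antipodal) (use orth nrm[OF \<rho>_char] in \<open>simp_all add: sum4 \<rho>_def\<close>)
    then consider "\<rho> b = - \<rho> a" "\<rho> d = - \<rho> c" | "\<rho> c = - \<rho> a" "\<rho> d = - \<rho> b"
      | "\<rho> d = - \<rho> a" "\<rho> c = - \<rho> b" by blast
    then show ?thesis
    proof cases
      case 1
      have "\<rho> x * cnj (\<phi> x) = cnj (\<psi> x)" for x
        using cnj_mult_unit[OF nrm[OF \<phi>, of x]] by (simp add: \<rho>_def mult_ac)
      hence "(\<Sum>x\<in>A. \<rho> x * cnj (\<phi> x)) = cnj (sum \<psi> A)" by simp
      then show ?thesis using tiles_if_same_pairing[OF \<rho>_char \<phi> A 1 \<phi>ab] s\<psi> by simp
    next
      case 2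
      \<comment> \<open>The conjugate of \<open>\<psi>\<close> has the same pairing as
        \<open>\<psi>\<close>, and its quotient with \<open>\<rho>\<close> is \<open>\<phi>\<close>,
        which has sum zero.\<close>
      have "\<rho> x * cnj (cnj (\<psi> x)) = \<phi> x" for x
        using cnj_mult_unit[OF nrm[OF \<psi>, of x]] by (simp add: \<rho>_def mult_ac)
      hence s: "(\<Sum>x\<in>A. \<rho> x * cnj (cnj (\<psi> x))) = 0" using s\<phi> by simp
      have A': "A = {a,c,b,d}" "distinct [a,c,b,d]" using A by auto
      show ?thesis
        by (rule tiles_if_same_pairing[OF \<rho>_char is_character_cnj[OF \<psi>] A' 2 _ _ s])
          (use \<psi>ac in simp_all)
    next
      case 3
      note u = cnj_mult_unit[OF nrm[OF \<psi>]]
      have eq: "\<phi> c * cnj (\<psi> b) = - (\<phi> a * cnj (\<psi> a))" "- (\<phi> c * cnj (\<psi> a)) = \<phi> a * cnj (\<psi> b)"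
        using 3 \<phi>ab \<psi>ac by (simp_all add: \<rho>_def)
      have "\<phi> c = - (\<phi> a * cnj (\<psi> a) * \<psi> b)" "\<phi> c = - (\<phi> a * cnj (\<psi> b) * \<psi> a)"
        using eq u[of b] u[of a] by algebra+
      hence "\<phi> a * (cnj (\<psi> a) * \<psi> b - cnj (\<psi> b) * \<psi> a) = 0" by algebra
      moreover have "\<phi> a \<noteq> 0" using nrm[OF \<phi>, of a] by auto
      ultimately have "cnj (\<psi> a) * \<psi> b = cnj (\<psi> b) * \<psi> a" by simp
      hence "(\<psi> b)\<^sup>2 = (\<psi> a)\<^sup>2" using u[of a] u[of b] by algebra
      then consider "\<psi> b = \<psi> a" | "\<psi> b = - \<psi> a" by (auto simp: power2_eq_iff)
      then show ?thesis
      proof cases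
        case 1
        then show ?thesis
          by (intro tiles_if_two_pairs[OF \<psi> \<phi> A(1) _ _ _ \<phi>ab]) (use \<psi>ac in simp_all)
      next
        case 2
        then show ?thesis
          by (intro tiles_if_same_pairing[OF \<phi> \<psi> A \<phi>ab _ _ orth]) (use \<psi>ac in simp_all)
      qed
    qed
  qed
  have step: "tiles A" if A: "A = {a,b,c,d}" "distinct [a,b,c,d]"
    and \<phi>ab: "\<phi> b = - \<phi> a" "\<phi> d = - \<phi> c" for a b c d
  proof -
    have sum4: "sum f A = f a + f b + f c + f d" for f :: "int ^ 'a \<Rightarrow> complex"
      using A by (simp add: add.assoc)
    have "\<psi> b = - \<psi> a \<and> \<psi> d = - \<psi> c \<or> \<psi> c = - \<psi> a \<and> \<psi> d = - \<psi> b \<or> \<psi> d = - \<psi> a \<and> \<psi> c = - \<psi> b"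
      by (rule zero_sum_four_antipodal) (use s\<psi> nrm[OF \<psi>] in \<open>simp_all add: sum4\<close>)
    then consider "\<psi> b = - \<psi> a" "\<psi> d = - \<psi> c" | "\<psi> c = - \<psi> a" "\<psi> d = - \<psi> b"
      | "\<psi> d = - \<psi> a" "\<psi> c = - \<psi> b" by blast
    then show ?thesis
    proof cases
      case 1
      then show ?thesis using tiles_if_same_pairing[OF \<phi> \<psi> A \<phi>ab _ _ orth] by blast
    next
      case 2
      then show ?thesis using main[OF A \<phi>ab] by blast
    next
      case 3
      have "A = {a,b,d,c}" "distinct [a,b,d,c]" "\<phi> c = - \<phi> d" using A \<phi>ab by auto
      then show ?thesis using main[of a b d c] \<phi>ab 3 by blast
    qed
  qed
  have A': "A = {a,c,b,d}" "distinct [a,c,b,d]" "A = {a,d,c,b}" "distinct [a,d,c,b]" using A by auto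
  from pairing[OF \<phi> s\<phi>] show ?thesis
  proof (elim disjE conjE)
    assume "\<phi> d = - \<phi> a" "\<phi> c = - \<phi> b"
    then show ?thesis using step[OF A'(3,4)] by simp
  qed (use step[OF A] step[OF A'(1,2)] in blast)+
qed

section \<open>Spectral sets with at most five elements\<close>

text \<open>Expanding the indicator of \<open>y\<close> in the characters gives, by orthogonality,
  the coefficients \<open>cnj (character m y)\<close> divided by the cardinality of
  \<open>A\<close>. Evaluating at \<open>x\<close> gives the dual relations, and
  \<open>x = y\<close> yields the cardinality of \<open>\<Lambda>\<close>.\<close>

lemma spectral_orthogonality:
  assumes "spectral A" "A \<noteq> {}"
  obtains \<Lambda> where "card \<Lambda> = card A"
    "\<And>l m. l \<in> \<Lambda> \<Longrightarrow> m \<in> \<Lambda> \<Longrightarrow> l \<noteq> m \<Longrightarrow> (\<Sum>x\<in>A. character l x * cnj (character m x)) = 0"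
    "\<And>x y. x \<in> A \<Longrightarrow> y \<in> A \<Longrightarrow>
      (\<Sum>l\<in>\<Lambda>. character l x * cnj (character l y)) = (if x = y then of_nat (card A) else 0)"
proof -
  obtain \<Lambda> where fin: "finite A" "finite \<Lambda>"
    and orth: "\<And>l m. l \<in> \<Lambda> \<Longrightarrow> m \<in> \<Lambda> \<Longrightarrow> l \<noteq> m \<Longrightarrow> (\<Sum>x\<in>A. character l x * cnj (character m x)) = 0"
    and span: "\<And>f. \<exists>c. \<forall>x\<in>A. f x = (\<Sum>l\<in>\<Lambda>. c l * character l x)"
    using assms(1) unfolding spectral_def by blast
  have unit: "character l x * cnj (character l x) = 1" for l and x :: "int ^ 'a"
    using is_character_character[of l] by (simp add: is_character_def cnj_mult_unit)
  have rows: "(\<Sum>l\<in>\<Lambda>. character l x * cnj (character l y)) = (if x = y then of_nat (card A) else 0)"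
    if x: "x \<in> A" and y: "y \<in> A" for x y
  proof -
    obtain c where c: "\<And>x. x \<in> A \<Longrightarrow> (if x = y then 1 else 0) = (\<Sum>l\<in>\<Lambda>. c l * character l x)"
      using span[of "\<lambda>x. if x = y then 1 else 0"] by blast
    have coeff: "cnj (character m y) = c m * of_nat (card A)" if m: "m \<in> \<Lambda>" for m
    proof -
      have "cnj (character m y) = (\<Sum>x\<in>A. (if x = y then 1 else 0) * cnj (character m x))"
        using fin y by (simp add: if_distrib[of "\<lambda>z. z * _"] cong: if_cong)
      also have "\<dots> = (\<Sum>x\<in>A. (\<Sum>l\<in>\<Lambda>. c l * character l x) * cnj (character m x))"
        using c by (intro sum.cong) auto
      also have "\<dots> = (\<Sum>l\<in>\<Lambda>. c l * (\<Sum>x\<in>A. character l x * cnj (character m x)))"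
        unfolding sum_distrib_left sum_distrib_right by (subst sum.swap) (simp add: mult_ac)
      also have "\<dots> = (\<Sum>l\<in>\<Lambda>. if l = m then c m * of_nat (card A) else 0)"
        using orth m unit by (intro sum.cong) auto
      finally show ?thesis using fin m by simp
    qed
    have "(\<Sum>l\<in>\<Lambda>. character l x * cnj (character l y)) = of_nat (card A) * (\<Sum>l\<in>\<Lambda>. c l * character l x)"
      using coeff by (simp add: sum_distrib_left mult_ac)
    then show ?thesis using c[OF x] by auto
  qed
  obtain x where "x \<in> A" using assms(2) by blast
  from rows[OF this this] have "of_nat (card \<Lambda>) = (of_nat (card A) :: complex)"
    by (simp add: unit)
  with orth rows that show ?thesis by (simp only: of_nat_eq_iff) blast
qed

theorem theorem2p3:
  fixes A :: "(int ^ 'd) set"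
  assumes "A \<noteq> {}" and "spectral A" and "card A \<le> 5"
  shows "tiles A"
proof -
  obtain \<Lambda> where card_\<Lambda>: "card \<Lambda> = card A"
    and col: "\<And>l m. l \<in> \<Lambda> \<Longrightarrow> m \<in> \<Lambda> \<Longrightarrow> l \<noteq> m \<Longrightarrow> (\<Sum>x\<in>A. character l x * cnj (character m x)) = 0"
    and row: "\<And>x y. x \<in> A \<Longrightarrow> y \<in> A \<Longrightarrow>
      (\<Sum>l\<in>\<Lambda>. character l x * cnj (character l y)) = (if x = y then of_nat (card A) else 0)"
    by (rule spectral_orthogonality[OF assms(2,1)]) (rule that; blast)
  define quot where "quot l m x = character l x * cnj (character m x)" for l m and x :: "int ^ 'd"
  have quot: "is_character (quot l m)" for l m
    unfolding quot_def[abs_def] by (intro is_character_mult_cnj is_character_character)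
  have nrm: "norm (quot l m x) = 1" for l m x using quot by (simp add: is_character_def)
  have nrm1: "norm (character l x) = 1" for l and x :: "int ^ 'd"
    using is_character_character[of l] by (simp add: is_character_def)
  have zero: "sum (quot l m) A = 0" if "l \<in> \<Lambda>" "m \<in> \<Lambda>" "l \<noteq> m" for l m
    using col[OF that] by (simp add: quot_def)
  have "finite A" using assms(2) by (simp add: spectral_def)
  hence "card A > 0" using assms(1) by (simp add: card_gt_0_iff)
  then consider "card A = 1" | "card A = 2" | "card A = 3" | "card A = 4" | "card A = 5"
    using assms(3) by linarith
  then show ?thesis
  proof cases
    case 1
    then obtain a where "A = {a}" by (auto simp: card_1_singleton_iff)
    \<comment> \<open>Every character is injective on a singleton, so an arbitrary one serves with
      \<open>n = 1\<close>.\<close>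
    then show ?thesis
      by (intro tiles_if_roots_of_unity[OF is_character_character 1, of undefined "character undefined a"]) auto
  next
    case 2
    have "card \<Lambda> = 2" using 2 card_\<Lambda> by simp
    then obtain l m where lm: "l \<in> \<Lambda>" "m \<in> \<Lambda>" "l \<noteq> m" unfolding card_2_iff by blast
    obtain a b where A: "A = {a,b}" "a \<noteq> b" using 2 by (auto simp: card_2_iff)
    have "quot l m b = - quot l m a" using zero[OF lm] A by (simp add: eq_neg_iff_add_eq_0 add.commute)
    moreover have "quot l m a \<noteq> 0" using nrm[of l m a] by auto
    ultimately show ?thesis
      by (intro tiles_if_roots_of_unity[OF quot[of l m] 2, of "(quot l m a)\<^sup>2"]) (auto simp: A)
  next
    case 3
    have "card \<Lambda> = 3" using 3 card_\<Lambda> by simp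
    then obtain l m where lm: "l \<in> \<Lambda>" "m \<in> \<Lambda>" "l \<noteq> m" unfolding card_3_iff by blast
    have eq: "quot l m a \<noteq> quot l m b \<and> quot l m a ^ 3 = quot l m b ^ 3"
      if "a \<in> A" "b \<in> A" "a \<noteq> b" for a b
    proof -
      have "card (A - {a,b}) = 1" using 3 that \<open>finite A\<close> by (simp add: card_Diff_subset)
      then obtain c where "A - {a,b} = {c}" by (auto simp: card_1_singleton_iff)
      hence "A = {a,b,c}" "c \<noteq> a" "c \<noteq> b" using that by blast+
      hence "quot l m a + quot l m b + quot l m c = 0"
        using zero[OF lm] that by (simp add: add.assoc)
      then show ?thesis using cubes_equal nrm by blast
    qed
    obtain a where "a \<in> A" using assms(1) by blast
    show ?thesis
      by (rule tiles_if_roots_of_unity[OF quot[of l m] 3, of "quot l m a ^ 3"])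
        (use eq \<open>a \<in> A\<close> in \<open>auto simp: inj_on_def\<close>)
  next
    case 4
    have "card \<Lambda> = 4" using 4 card_\<Lambda> by simp
    then obtain l m n where lmn: "l \<in> \<Lambda>" "m \<in> \<Lambda>" "n \<in> \<Lambda>" "l \<noteq> n" "m \<noteq> n" "l \<noteq> m"
      by (auto simp: card_Suc_eq eval_nat_numeral)
    have "quot l n x * cnj (quot m n x) = quot l m x" for x
      using cnj_mult_unit[OF nrm1, of n x] by (simp add: quot_def mult_ac)
    then show ?thesis
      by (intro tiles_four[OF quot[of l n] quot[of m n] 4] zero lmn) (simp add: zero lmn)
  next
    case 5
    obtain l m where lm: "l \<in> \<Lambda>" "m \<in> \<Lambda>" "l \<noteq> m" "(\<Sum>x\<in>A. (quot l m x)\<^sup>2) = 0"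
      unfolding quot_def
      by (rule hadamard_five_squares_orthogonal[of \<Lambda> A character]) (use 5 card_\<Lambda> nrm1 col row in simp_all)
    \<comment> \<open>Any two points of \<open>A\<close> can be put first in a labelling, so this
      gives both injectivity and the common fifth power.\<close>
    have eq: "quot l m a ^ 5 = quot l m b ^ 5 \<and> quot l m a \<noteq> quot l m b"
      if ab: "a \<in> A" "b \<in> A" "a \<noteq> b" for a b
    proof -
      obtain c d e where A: "A = {a,b,c,d,e}" "distinct [a,b,c,d,e]"
        using card_five_split[OF 5 ab] by blast
      show ?thesis
        using fifth_powers_equal[OF nrm nrm nrm nrm nrm, of l m a l m b l m c l m d l m e]
          zero[OF lm(1-3)] lm(4) unfolding A(1) sum_five[OF A(2)] by blast
    qed
    obtain a where "a \<in> A" using assms(1) by blast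
    show ?thesis
      by (rule tiles_if_roots_of_unity[OF quot[of l m] 5, of "quot l m a ^ 5"])
        (use eq \<open>a \<in> A\<close> in \<open>auto simp: inj_on_def\<close>)
  qed
qed

end
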